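(* If $X$ is Type I (in itself) and countably compact, then the posets $\mathfrak{N}(X)$ and $\mathfrak{N}_f(X)$ are upwards and downwards countably closed; that is, in each of them every strictly increasing $\omega$-sequence has an upper bound and every strictly decreasing $\omega$-sequence has a lower bound.
   Context: "Space" means Hausdorff topological space. The longray $\mathbb{L}_{\ge 0}$ is $\omega_1\times[0,1)$ with the lexicographic order topology; $\alpha\in\omega_1$ is identified with $\langle\alpha,0\rangle$. A function into $\mathbb{L}_{\ge 0}$ is bounded if its range is contained in a strict initial segment. A systematic cover of $X$ indexed by $\omega_1$ is an open cover $\{U_\alpha:\alpha\in\omega_1\}$ with $\overline{U_\alpha}\subset U_\beta$ whenever $\alpha<\beta$. $X$ is Type I if it has such a cover with every $\overline{U_\alpha}$ Lindelöf. A closed $D\subset X$ is narrow in $X$ if for every systematic cover $\{U_\alpha:\alpha\in\omega_1\}$ of $X$, either $D\subset U_\alpha$ for some $\alpha$ or $\overline{U_\alpha}\cap D$ is Lindelöf for each $\alpha$. It is f-narrow in $X$ if for every continuous $f:X\to\mathbb{L}_{\ge 0}$, either $f\upharpoonright D$ is bounded or $f^{-1}([0,\alpha])\cap D$ is Lindelöf for each $\alpha\in\omega_1$. For closed $C,D\subset X$: $C\preceq D$ iff for any systematic cover $\{U_\alpha:\alpha\in\omega_1\}$ of $X$, if $D\subset U_\alpha$ for some $\alpha$ then $C\subset U_\beta$ for some $\beta$; $C\preceq_f D$ iff for any continuous $f:X\to\mathbb{L}_{\ge 0}$, if $f\upharpoonright D$ is bounded then $f\upharpoonright C$ is bounded.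 Write $C\equiv D$ if $C\preceq D\preceq C$, and $C\equiv_f D$ if $C\preceq_f D\preceq_f C$. $\mathfrak{N}(X)$ is the poset, ordered by $\preceq$, of $\equiv$-classes of closed non-Lindelöf subsets of $X$ that are narrow in $X$. $\mathfrak{N}_f(X)$ is the poset, ordered by $\preceq_f$, of $\equiv_f$-classes of closed non-Lindelöf subsets of $X$ that are f-narrow in $X$. *)

theory Defs
  imports "HOL-Analysis.Analysis" "HOL-Library.Countable_Set_Type"
begin

section \<open>The first uncountable ordinal\<close>

text \<open>
  The relation \<open>cardSuc natLeq\<close> well-orders its field in the order type of the least cardinal
  above that of the natural numbers, that is, in type \<open>\<omega>\<^sub>1\<close>.
\<close>

typedef omega1 = "Field (cardSuc natLeq)"
proof -
  have "infinite (Field (cardSuc natLeq))"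
    using cardSuc_finite[OF natLeq_Card_order] Field_natLeq infinite_UNIV_nat by simp
  then have "Field (cardSuc natLeq) \<noteq> {}" by auto
  then show ?thesis by blast
qed

lemma Well_order_cardSuc_natLeq: "Well_order (cardSuc natLeq)"
  using cardSuc_Card_order[OF natLeq_Card_order] card_order_on_well_order_on by blast

instantiation omega1 :: wellorder
begin

definition less_eq_omega1 :: "omega1 \<Rightarrow> omega1 \<Rightarrow> bool"
  where "less_eq_omega1 a b \<longleftrightarrow> (Rep_omega1 a, Rep_omega1 b) \<in> cardSuc natLeq"

definition less_omega1 :: "omega1 \<Rightarrow> omega1 \<Rightarrow> bool"
  where "less_omega1 a b \<longleftrightarrow> a \<le> b \<and> \<not> b \<le> a"

instance
proof
  note wo = Well_order_cardSuc_natLeq[unfolded well_order_on_def linear_order_on_def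
      partial_order_on_def preorder_on_def]
  fix x y z :: omega1
  show "x < y \<longleftrightarrow> x \<le> y \<and> \<not> y \<le> x" by (rule less_omega1_def)
  show "x \<le> x" using wo Rep_omega1 by (auto simp: less_eq_omega1_def refl_on_def)
  show "x \<le> y \<Longrightarrow> y \<le> z \<Longrightarrow> x \<le> z" using wo unfolding less_eq_omega1_def by (blast dest: transD)
  show anti: "x \<le> y \<Longrightarrow> y \<le> x \<Longrightarrow> x = y" for x y :: omega1
    using wo antisymD[of "cardSuc natLeq" "Rep_omega1 x" "Rep_omega1 y"]
    unfolding less_eq_omega1_def by (simp add: Rep_omega1_inject)
  show "x \<le> y \<or> y \<le> x" using wo Rep_omega1
    unfolding less_eq_omega1_def by (cases "x = y") (auto simp: refl_on_def total_on_def Rep_omega1_inject)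
  fix P :: "omega1 \<Rightarrow> bool" and a :: omega1
  assume step: "\<And>x. (\<And>y. y < x \<Longrightarrow> P y) \<Longrightarrow> P x"
  have "wf (inv_image (cardSuc natLeq - Id) Rep_omega1)"
    using wo by (intro wf_inv_image) auto
  then show "P a"
  proof (induction a rule: wf_induct_rule)
    case (less x)
    show ?case
    proof (rule step)
      fix y assume "y < x"
      then have "y \<le> x" "y \<noteq> x" by (auto simp: less_omega1_def)
      then show "P y" using less
        by (auto simp: less_eq_omega1_def Rep_omega1_inject in_inv_image)
    qed
  qed
qed

end

lemma uncountable_omega1:
  includes cardinal_syntax
  shows "uncountable (UNIV :: omega1 set)"
proof
  assume "countable (UNIV :: omega1 set)"
  then have "countable (range Rep_omega1)" by simp
  then have "countable (Field (cardSuc natLeq))"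
    using type_definition.Rep_range[OF type_definition_omega1] by simp
  then have "cardSuc natLeq \<le>o natLeq"
    unfolding countable_card_le_natLeq
    by (rule ordIso_ordLeq_trans[OF ordIso_symmetric
          [OF card_of_Field_ordIso[OF cardSuc_Card_order[OF natLeq_Card_order]]]])
  then show False
    using cardSuc_greater[OF natLeq_Card_order] not_ordLess_ordLeq by blast
qed

lemma countable_lessThan_omega1:
  includes cardinal_syntax
  shows "countable {..< a :: omega1}"
proof -
  have "|underS (cardSuc natLeq) (Rep_omega1 a)| <o cardSuc natLeq"
    by (rule card_of_underS[OF cardSuc_Card_order[OF natLeq_Card_order] Rep_omega1])
  then have "countable (underS (cardSuc natLeq) (Rep_omega1 a))"
    unfolding countable_card_le_natLeq
    using cardSuc_ordLeq_ordLess[OF natLeq_Card_order card_of_Card_order] by blast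
  moreover have "Rep_omega1 ` {..<a} \<subseteq> underS (cardSuc natLeq) (Rep_omega1 a)"
    by (auto simp: underS_def less_eq_omega1_def Rep_omega1_inject dest: less_imp_le)
  ultimately have "countable (Rep_omega1 ` {..<a})" by (rule countable_subset[rotated])
  then show ?thesis
    by (rule countable_image_inj_on) (simp add: inj_on_def Rep_omega1_inject)
qed


section \<open>The longray\<close>

typedef longray = "UNIV \<times> {0..<1} :: (omega1 \<times> real) set"
  by (rule exI[of _ "(undefined, 0)"]) simp

setup_lifting type_definition_longray

instantiation longray :: linorder
begin

lift_definition less_eq_longray :: "longray \<Rightarrow> longray \<Rightarrow> bool"
  is "\<lambda>p q. fst p < fst q \<or> fst p = fst q \<and> snd p \<le> snd q" .

lift_definition less_longray :: "longray \<Rightarrow> longray \<Rightarrow> bool"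
  is "\<lambda>p q. fst p < fst q \<or> fst p = fst q \<and> snd p < snd q" .

instance
  by standard (transfer; force simp: prod_eq_iff)+

end

instantiation longray :: linorder_topology
begin

definition open_longray :: "longray set \<Rightarrow> bool"
  where "open_longray = generate_topology (range (\<lambda>a. {..< a}) \<union> range (\<lambda>a. {a <..}))"

instance
  by standard (rule open_longray_def)

end

text \<open>The identification of an ordinal \<open>\<alpha> < \<omega>\<^sub>1\<close> with the point \<open>(\<alpha>, 0)\<close>.\<close>

lift_definition longray_of :: "omega1 \<Rightarrow> longray" is "\<lambda>a. (a, 0)" by simp

lemma longray_of_le_iff [simp]: "longray_of a \<le> longray_of b \<longleftrightarrow> a \<le> b"
  by transfer auto

lemma longray_of_least: "longray_of (LEAST a. True) \<le> x"
  by transfer (auto intro: Least_le antisym simp: not_less)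

text \<open>Contained in a strict initial segment.\<close>

definition longray_bounded :: "longray set \<Rightarrow> bool"
  where "longray_bounded S \<longleftrightarrow>
    (\<exists>I. (\<forall>x\<in>I. \<forall>y\<le>x. y \<in> I) \<and> I \<noteq> UNIV \<and> S \<subseteq> I)"

lemma longray_bounded_iff: "longray_bounded S \<longleftrightarrow> (\<exists>b. S \<subseteq> {..<b})"
proof
  assume "longray_bounded S"
  then obtain I b where I: "\<forall>x\<in>I. \<forall>y\<le>x. y \<in> I" "b \<notin> I" "S \<subseteq> I"
    unfolding longray_bounded_def by blast
  then have "S \<subseteq> {..<b}" by (metis lessThan_iff not_le subset_iff)
  then show "\<exists>b. S \<subseteq> {..<b}" ..
next
  assume "\<exists>b. S \<subseteq> {..<b}"
  then obtain b where "S \<subseteq> {..<b}" ..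
  then show "longray_bounded S"
    unfolding longray_bounded_def
    by (intro exI[of _ "{..<b}"]) (auto intro: le_less_trans)
qed


section \<open>Systematic covers and Type I spaces\<close>

definition countably_compact_space :: "'a topology \<Rightarrow> bool"
  where "countably_compact_space X \<longleftrightarrow>
    (\<forall>\<U>. countable \<U> \<longrightarrow> (\<forall>U\<in>\<U>. openin X U) \<longrightarrow> topspace X \<subseteq> \<Union>\<U> \<longrightarrow>
      (\<exists>\<F>\<subseteq>\<U>. finite \<F> \<and> topspace X \<subseteq> \<Union>\<F>))"

lemma countably_compact_space_euclidean:
  "countably_compact_space (euclidean :: 'a::topological_space topology)
    \<longleftrightarrow> countably_compact (UNIV :: 'a set)"
  by (simp add: countably_compact_space_def countably_compact_def)

abbreviation Lindelof_in :: "'a topology \<Rightarrow> 'a set \<Rightarrow> bool"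
  where "Lindelof_in X S \<equiv> Lindelof_space (subtopology X S)"

definition systematic_cover :: "'a topology \<Rightarrow> (omega1 \<Rightarrow> 'a set) \<Rightarrow> bool"
  where "systematic_cover X U \<longleftrightarrow>
    (\<forall>\<alpha>. openin X (U \<alpha>)) \<and> (\<Union>\<alpha>. U \<alpha>) = topspace X \<and>
    (\<forall>\<alpha> \<beta>. \<alpha> < \<beta> \<longrightarrow> X closure_of U \<alpha> \<subseteq> U \<beta>)"

definition type_I :: "'a topology \<Rightarrow> bool"
  where "type_I X \<longleftrightarrow>
    (\<exists>U. systematic_cover X U \<and> (\<forall>\<alpha>. Lindelof_in X (X closure_of U \<alpha>)))"


section \<open>Narrow sets and the two preorders\<close>

definition narrow :: "'a topology \<Rightarrow> 'a set \<Rightarrow> bool"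
  where "narrow X D \<longleftrightarrow> closedin X D \<and>
    (\<forall>U. systematic_cover X U \<longrightarrow>
      (\<exists>\<alpha>. D \<subseteq> U \<alpha>) \<or> (\<forall>\<alpha>. Lindelof_in X (X closure_of U \<alpha> \<inter> D)))"

definition f_narrow :: "'a topology \<Rightarrow> 'a set \<Rightarrow> bool"
  where "f_narrow X D \<longleftrightarrow> closedin X D \<and>
    (\<forall>f :: 'a \<Rightarrow> longray. continuous_map X euclidean f \<longrightarrow>
      longray_bounded (f ` D) \<or> (\<forall>\<alpha>. Lindelof_in X (f -` {..longray_of \<alpha>} \<inter> D)))"

definition narrow_le :: "'a topology \<Rightarrow> 'a set \<Rightarrow> 'a set \<Rightarrow> bool"
  where "narrow_le X C D \<longleftrightarrow>
    (\<forall>U. systematic_cover X U \<longrightarrow> (\<exists>\<alpha>. D \<subseteq> U \<alpha>) \<longrightarrow> (\<exists>\<beta>. C \<subseteq> U \<beta>))"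

definition f_narrow_le :: "'a topology \<Rightarrow> 'a set \<Rightarrow> 'a set \<Rightarrow> bool"
  where "f_narrow_le X C D \<longleftrightarrow>
    (\<forall>f :: 'a \<Rightarrow> longray. continuous_map X euclidean f \<longrightarrow>
      longray_bounded (f ` D) \<longrightarrow> longray_bounded (f ` C))"


section \<open>The posets of equivalence classes\<close>

text \<open>The equivalence induced by a preorder \<open>le\<close> on a set \<open>A\<close>, and the induced order on classes.\<close>

definition equiv_of :: "'b set \<Rightarrow> ('b \<Rightarrow> 'b \<Rightarrow> bool) \<Rightarrow> ('b \<times> 'b) set"
  where "equiv_of A le = {(C, D). C \<in> A \<and> D \<in> A \<and> le C D \<and> le D C}"

definition class_le :: "('b \<Rightarrow> 'b \<Rightarrow> bool) \<Rightarrow> 'b set \<Rightarrow> 'b set \<Rightarrow> bool"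
  where "class_le le P Q \<longleftrightarrow> (\<exists>C\<in>P. \<exists>D\<in>Q. le C D)"

definition narrow_sets :: "'a topology \<Rightarrow> 'a set set"
  where "narrow_sets X = {D. closedin X D \<and> \<not> Lindelof_in X D \<and> narrow X D}"

definition f_narrow_sets :: "'a topology \<Rightarrow> 'a set set"
  where "f_narrow_sets X = {D. closedin X D \<and> \<not> Lindelof_in X D \<and> f_narrow X D}"

definition narrow_poset :: "'a topology \<Rightarrow> 'a set set set"
  where "narrow_poset X = narrow_sets X // equiv_of (narrow_sets X) (narrow_le X)"

definition f_narrow_poset :: "'a topology \<Rightarrow> 'a set set set"
  where "f_narrow_poset X = f_narrow_sets X // equiv_of (f_narrow_sets X) (f_narrow_le X)"

definition upwards_countably_closed :: "'b set \<Rightarrow> ('b \<Rightarrow> 'b \<Rightarrow> bool) \<Rightarrow> bool"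
  where "upwards_countably_closed P le \<longleftrightarrow>
    (\<forall>s :: nat \<Rightarrow> 'b. (\<forall>n. s n \<in> P) \<and> (\<forall>m n. m < n \<longrightarrow> le (s m) (s n) \<and> s m \<noteq> s n) \<longrightarrow>
      (\<exists>u\<in>P. \<forall>n. le (s n) u))"

definition downwards_countably_closed :: "'b set \<Rightarrow> ('b \<Rightarrow> 'b \<Rightarrow> bool) \<Rightarrow> bool"
  where "downwards_countably_closed P le \<longleftrightarrow>
    (\<forall>s :: nat \<Rightarrow> 'b. (\<forall>n. s n \<in> P) \<and> (\<forall>m n. m < n \<longrightarrow> le (s n) (s m) \<and> s n \<noteq> s m) \<longrightarrow>
      (\<exists>l\<in>P. \<forall>n. le l (s n)))"

lemma equiv_equiv_of:
  assumes "reflp le" "transp le"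
  shows "equiv A (equiv_of A le)"
proof (rule equivI)
  show "refl_on A (equiv_of A le)"
    using assms(1) by (auto simp: equiv_of_def refl_on_def dest: reflpD)
  show "sym (equiv_of A le)" by (auto simp: equiv_of_def sym_def)
  show "trans (equiv_of A le)"
    using assms(2) by (auto simp: equiv_of_def intro!: transI dest: transpD)
qed (auto simp: equiv_of_def)

lemma class_le_iff:
  assumes "reflp le" "transp le" "C \<in> A" "D \<in> A"
  shows "class_le le (equiv_of A le `` {C}) (equiv_of A le `` {D}) \<longleftrightarrow> le C D"
  using assms unfolding class_le_def equiv_of_def
  by (auto dest: transpD reflpD)

lemma partial_order_on_classes:
  assumes "reflp le" "transp le"
  shows "partial_order_on (A // equiv_of A le)
    {(P, Q). P \<in> A // equiv_of A le \<and> Q \<in> A // equiv_of A le \<and> class_le le P Q}"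
  unfolding partial_order_on_def preorder_on_def
proof (intro conjI)
  note iff = class_le_iff[OF assms]
  let ?Q = "A // equiv_of A le"
  let ?r = "{(P, Q). P \<in> ?Q \<and> Q \<in> ?Q \<and> class_le le P Q}"
  show "?r \<subseteq> ?Q \<times> ?Q" by auto
  show "refl_on ?Q ?r"
    using assms(1) by (auto simp: refl_on_def iff dest: reflpD elim!: quotientE)
  show "trans ?r"
  proof (rule transI)
    fix P Q R assume "(P, Q) \<in> ?r" "(Q, R) \<in> ?r"
    moreover from this obtain C D E where "C \<in> A" "D \<in> A" "E \<in> A"
      "P = equiv_of A le `` {C}" "Q = equiv_of A le `` {D}" "R = equiv_of A le `` {E}"
      by (auto elim!: quotientE)
    ultimately show "(P, R) \<in> ?r"
      using assms(2) by (auto simp: iff dest: transpD)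
  qed
  show "antisym ?r"
  proof (rule antisymI)
    fix P Q assume "(P, Q) \<in> ?r" "(Q, P) \<in> ?r"
    then obtain C D where "C \<in> A" "D \<in> A" "le C D" "le D C"
      "P = equiv_of A le `` {C}" "Q = equiv_of A le `` {D}"
      by (auto simp: iff elim!: quotientE)
    then show "P = Q"
      using equiv_class_eq[OF equiv_equiv_of[OF assms], of C D A] by (simp add: equiv_of_def)
  qed
qed

lemma reflp_narrow_le: "reflp (narrow_le X)" and transp_narrow_le: "transp (narrow_le X)"
  by (auto simp: narrow_le_def intro!: reflpI transpI)

lemma reflp_f_narrow_le: "reflp (f_narrow_le X)" and transp_f_narrow_le: "transp (f_narrow_le X)"
  by (auto simp: f_narrow_le_def intro!: reflpI transpI)

end

theory Submission
  imports Defs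
begin

text \<open>
  One set serves as a bound in all four cases. For a monotone sequence \<open>D\<^sub>n\<close> of narrow sets let
  \<open>L = \<Inter>\<^sub>m E\<^sub>m\<close> with \<open>E\<^sub>m\<close> the closure of \<open>\<Union>\<^sub>n\<^sub>\<ge>\<^sub>m D\<^sub>n\<close>. By countable compactness an open set
  containing \<open>L\<close> contains some \<open>E\<^sub>m\<close>, so a systematic cover with a member containing \<open>L\<close> has one
  containing almost all \<open>D\<^sub>n\<close>; conversely, if almost every \<open>D\<^sub>n\<close> lies in a member, so does \<open>L\<close>,
  since countable subsets of \<open>\<omega>\<^sub>1\<close> are bounded. If almost no \<open>D\<^sub>n\<close> lies in a member, then each member
  meets these \<open>D\<^sub>n\<close> in a set contained in one Lindelof piece of \<open>X\<close>. Monotonicity excludes any other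
  behaviour. Functions into the longray enter only through the systematic covers
  \<open>f\<^sup>-\<^sup>1[0,\<alpha>)\<close>, so the argument is run for an arbitrary family \<open>\<S>\<close> of systematic covers.
\<close>

section \<open>Ordinals and the longray\<close>

text \<open>The initial segments \<open>{..a}\<close> with \<open>a\<close> in \<open>A\<close> have
  a countable union, and any ordinal outside this union lies strictly above all of
  \<open>A\<close>.\<close>

lemma countable_omega1_bounded:
  fixes A :: "omega1 set"
  assumes "countable A"
  obtains b where "\<And>a. a \<in> A \<Longrightarrow> a < b"
proof -
  have "{..a} = insert a {..<a}" for a :: omega1
    by auto
  then have "countable (\<Union>a\<in>A. {..a})"
    using assms by (simp add: countable_lessThan_omega1)
  then obtain b where "b \<notin> (\<Union>a\<in>A. {..a})"
    using uncountable_omega1 by (metis UNIV_eq_I)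
  then show thesis
    using that by (auto simp: not_le)
qed

lemma greater_omega1: obtains b :: omega1 where "a < b"
  using countable_omega1_bounded[of "{a}"] by auto

lemma longray_of_less_iff [simp]: "longray_of a < longray_of b \<longleftrightarrow> a < b"
  by (simp add: less_le_not_le)

lemma less_longray_of: obtains a where "x < longray_of a"
proof -
  obtain a where "fst (Rep_longray x) < a"
    using greater_omega1 by blast
  then have "x < longray_of a"
    by (simp add: less_longray.rep_eq longray_of.rep_eq)
  then show thesis by (rule that)
qed

text \<open>The ordinals are cofinal in the longray, so a bound can always be taken among them; this
  lets bounds serve as indices of a cover.\<close>

lemma longray_bounded_iff_longray_of: "longray_bounded S \<longleftrightarrow> (\<exists>a. S \<subseteq> {..<longray_of a})"
proof
  assume "longray_bounded S"
  then obtain b where "S \<subseteq> {..<b}"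
    by (auto simp: longray_bounded_iff)
  moreover obtain a where "b < longray_of a"
    by (rule less_longray_of)
  ultimately show "\<exists>a. S \<subseteq> {..<longray_of a}"
    by (auto intro!: exI[of _ a])
qed (auto simp: longray_bounded_iff)


section \<open>Systematic covers\<close>

lemma systematic_coverD:
  assumes "systematic_cover X U"
  shows "openin X (U a)" "(\<Union>a. U a) = topspace X" "a < b \<Longrightarrow> X closure_of U a \<subseteq> U b"
  using assms by (auto simp: systematic_cover_def)

lemma systematic_cover_mono:
  assumes "systematic_cover X U" "a \<le> b"
  shows "U a \<subseteq> U b"
proof (cases "a = b")
  case False
  then show ?thesis
    using assms systematic_coverD(3)[OF assms(1), of a b] systematic_coverD(1)[OF assms(1), of a]
      closure_of_subset[of "U a" X] openin_subset by fastforce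
qed simp

text \<open>Choosing one index for each \<open>i\<close> gives a countable set of ordinals, which
  has a common upper bound, and members of a systematic cover increase with the index.\<close>

lemma systematic_cover_countable_Union:
  assumes U: "systematic_cover X U" and "countable I" and D: "\<And>i. i \<in> I \<Longrightarrow> \<exists>a. D i \<subseteq> U a"
  shows "\<exists>b. (\<Union>i\<in>I. D i) \<subseteq> U b"
proof -
  obtain a where a: "\<And>i. i \<in> I \<Longrightarrow> D i \<subseteq> U (a i)"
    using D by metis
  obtain b where "\<And>i. i \<in> I \<Longrightarrow> a i < b"
    using countable_omega1_bounded[of "a ` I"] \<open>countable I\<close>
    by (metis countable_image imageI)
  then have "D i \<subseteq> U b" if "i \<in> I" for i
    using a[OF that] that systematic_cover_mono[OF U less_imp_le] by blast
  then show ?thesis by blast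
qed

text \<open>A countable subcover involves only countably many indices, so its union fits into one
  member.\<close>

lemma Lindelof_subset_systematic_cover:
  assumes U: "systematic_cover X U" and K: "Lindelof_in X K" "K \<subseteq> topspace X"
  shows "\<exists>a. K \<subseteq> U a"
proof -
  have "\<forall>V\<in>range U. openin X V" "K \<subseteq> \<Union>(range U)"
    using systematic_coverD(1,2)[OF U] K(2) by auto
  then obtain \<V> where \<V>: "countable \<V>" "\<V> \<subseteq> range U" "K \<subseteq> \<Union>\<V>"
    using K(1)[unfolded Lindelof_space_subtopology_subset[OF K(2)], rule_format, of "range U"] by blast
  have "\<exists>b. (\<Union>V\<in>\<V>. V) \<subseteq> U b"
    by (rule systematic_cover_countable_Union[OF U \<V>(1)]) (use \<V>(2) in blast)
  then show ?thesis
    using \<V>(3) by auto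
qed

lemma Lindelof_in_closed_subset:
  assumes "Lindelof_in X K" "closedin X C" "C \<subseteq> K"
  shows "Lindelof_in X C"
proof -
  have "Lindelof_space (subtopology (subtopology X K) C)"
    using assms by (intro Lindelof_space_closedin_subtopology[OF assms(1)] closedin_subset_topspace)
  then show ?thesis
    using \<open>C \<subseteq> K\<close> by (simp add: subtopology_subtopology inf.absorb2)
qed


section \<open>Narrowness relative to a family of systematic covers\<close>

definition narrow_wrt :: "(omega1 \<Rightarrow> 'a set) set \<Rightarrow> 'a topology \<Rightarrow> 'a set \<Rightarrow> bool"
  where "narrow_wrt \<S> X D \<longleftrightarrow> closedin X D \<and>
    (\<forall>U\<in>\<S>. (\<exists>\<alpha>. D \<subseteq> U \<alpha>) \<or> (\<forall>\<alpha>. Lindelof_in X (X closure_of U \<alpha> \<inter> D)))"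

definition narrow_le_wrt :: "(omega1 \<Rightarrow> 'a set) set \<Rightarrow> 'a set \<Rightarrow> 'a set \<Rightarrow> bool"
  where "narrow_le_wrt \<S> C D \<longleftrightarrow> (\<forall>U\<in>\<S>. (\<exists>\<alpha>. D \<subseteq> U \<alpha>) \<longrightarrow> (\<exists>\<beta>. C \<subseteq> U \<beta>))"

lemma narrow_le_wrtD:
  assumes "narrow_le_wrt \<S> C D" "U \<in> \<S>" "\<exists>a. D \<subseteq> U a"
  shows "\<exists>b. C \<subseteq> U b"
  using assms by (simp add: narrow_le_wrt_def)

lemma narrow_wrt_systematic_covers: "narrow_wrt {U. systematic_cover X U} X D \<longleftrightarrow> narrow X D"
  by (simp add: narrow_wrt_def narrow_def)

lemma narrow_le_wrt_systematic_covers: "narrow_le_wrt {U. systematic_cover X U} C D \<longleftrightarrow> narrow_le X C D"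
  by (simp add: narrow_le_wrt_def narrow_le_def)

section \<open>Systematic covers induced by functions into the longray\<close>

text \<open>The strict inequality makes the members open when \<open>f\<close> is continuous. The
  restriction to \<open>topspace X\<close> discards the arbitrary values that the total function
  \<open>f\<close> takes elsewhere.\<close>

definition preimage_cover :: "'a topology \<Rightarrow> ('a \<Rightarrow> longray) \<Rightarrow> omega1 \<Rightarrow> 'a set"
  where "preimage_cover X f a = {x \<in> topspace X. f x < longray_of a}"

definition preimage_covers :: "'a topology \<Rightarrow> (omega1 \<Rightarrow> 'a set) set"
  where "preimage_covers X = {preimage_cover X f |f. continuous_map X euclidean f}"

lemma closure_of_preimage_cover:
  assumes "continuous_map X euclidean f"
  shows "X closure_of preimage_cover X f a \<subseteq> {x \<in> topspace X. f x \<le> longray_of a}"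
  using closedin_continuous_map_preimage[OF assms, of "{..longray_of a}"]
  by (intro closure_of_minimal) (auto simp: preimage_cover_def)

lemma systematic_cover_preimage_cover:
  assumes f: "continuous_map X euclidean f"
  shows "systematic_cover X (preimage_cover X f)"
  unfolding systematic_cover_def
proof (intro conjI allI impI)
  show "openin X (preimage_cover X f a)" for a
    using openin_continuous_map_preimage[OF f, of "{..<longray_of a}"] by (simp add: preimage_cover_def)
  show "(\<Union>a. preimage_cover X f a) = topspace X"
    by (auto simp: preimage_cover_def intro: less_longray_of)
  show "X closure_of preimage_cover X f a \<subseteq> preimage_cover X f b" if "a < b" for a b
    using closure_of_preimage_cover[OF f, of a] that
    by (force simp: preimage_cover_def intro: le_less_trans)
qed

lemma longray_bounded_image_iff:
  assumes "D \<subseteq> topspace X"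
  shows "longray_bounded (f ` D) \<longleftrightarrow> (\<exists>a. D \<subseteq> preimage_cover X f a)"
  using assms by (fastforce simp: longray_bounded_iff_longray_of preimage_cover_def)

text \<open>The closure of \<open>preimage_cover X f a\<close> may be strictly smaller than the
  preimage of \<open>{..longray_of a}\<close> in \<open>X\<close>, but that preimage lies in the
  member at any larger index. As both conditions range over all indices, the Lindelof property
  passes between them through closed subsets.\<close>

lemma narrow_wrt_preimage_covers: "narrow_wrt (preimage_covers X) X D \<longleftrightarrow> f_narrow X D"
proof -
  have "(\<forall>a. Lindelof_in X (X closure_of preimage_cover X f a \<inter> D)) \<longleftrightarrow>
      (\<forall>a. Lindelof_in X (f -` {..longray_of a} \<inter> D))" (is "(\<forall>a. ?L a) \<longleftrightarrow> (\<forall>a. ?R a)")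
    if f: "continuous_map X euclidean f" and D: "closedin X D" for f
  proof (intro iffI allI)
    have closed: "closedin X (f -` {..longray_of a} \<inter> D)" for a
    proof -
      have "f -` {..longray_of a} \<inter> D = {x \<in> topspace X. f x \<in> {..longray_of a}} \<inter> D"
        using closedin_subset[OF D] by auto
      then show ?thesis
        using closedin_continuous_map_preimage[OF f, of "{..longray_of a}"] D by auto
    qed
    show "?R a" if L: "\<forall>a. ?L a" for a
    proof -
      obtain b where "a < b"
        by (rule greater_omega1)
      then have "f -` {..longray_of a} \<inter> D \<subseteq> preimage_cover X f b"
        using closedin_subset[OF D] by (auto simp: preimage_cover_def intro: le_less_trans)
      also have "\<dots> \<subseteq> X closure_of preimage_cover X f b"
        by (rule closure_of_subset) (auto simp: preimage_cover_def)
      finally show ?thesis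
        using Lindelof_in_closed_subset[OF L[rule_format, of b] closed[of a]] by blast
    qed
    show "?L a" if "\<forall>a. ?R a" for a
      using that[rule_format, of a] closure_of_preimage_cover[OF f, of a] D
      by (rule_tac Lindelof_in_closed_subset) auto
  qed
  moreover have "longray_bounded (f ` D) \<longleftrightarrow> (\<exists>a. D \<subseteq> preimage_cover X f a)" if "closedin X D" for f
    by (rule longray_bounded_image_iff[OF closedin_subset[OF that]])
  moreover have "(\<forall>U\<in>preimage_covers X. Q U) \<longleftrightarrow>
      (\<forall>f. continuous_map X euclidean f \<longrightarrow> Q (preimage_cover X f))" for Q
    by (auto simp: preimage_covers_def)
  ultimately show ?thesis
    unfolding narrow_wrt_def f_narrow_def by (simp cong: conj_cong)
qed

lemma narrow_le_wrt_preimage_covers: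
  assumes "C \<subseteq> topspace X" "D \<subseteq> topspace X"
  shows "narrow_le_wrt (preimage_covers X) C D \<longleftrightarrow> f_narrow_le X C D"
  using longray_bounded_image_iff[OF assms(1)] longray_bounded_image_iff[OF assms(2)]
  by (auto simp: narrow_le_wrt_def f_narrow_le_def preimage_covers_def)


section \<open>The upper limit of a sequence of closed sets\<close>

text \<open>This is the Kuratowski upper limit: the points of \<open>topspace X\<close> all of whose
  neighbourhoods meet \<open>D n\<close> for infinitely many \<open>n\<close>.\<close>

definition upper_limit :: "'a topology \<Rightarrow> (nat \<Rightarrow> 'a set) \<Rightarrow> 'a set"
  where "upper_limit X D = (\<Inter>m. X closure_of (\<Union>n\<in>{m..}. D n))"

lemma closedin_upper_limit: "closedin X (upper_limit X D)"
  unfolding upper_limit_def by (rule closedin_Inter) auto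

text \<open>The closures of the tails decrease to a set inside \<open>V\<close>, so their
  complements together with \<open>V\<close> form a countable open cover; a finite subcover uses
  only finitely many tails.\<close>

lemma upper_limit_subset_openD:
  assumes cc: "countably_compact_space X" and D: "\<And>n. D n \<subseteq> topspace X"
    and V: "openin X V" "upper_limit X D \<subseteq> V"
  shows "\<exists>m. \<forall>n\<ge>m. D n \<subseteq> V"
proof -
  define E where "E m = X closure_of (\<Union>n\<in>{m..}. D n)" for m
  have E_anti: "E n \<subseteq> E m" if "m \<le> n" for m n
    unfolding E_def using that by (intro closure_of_mono UN_mono) auto
  define \<U> where "\<U> = insert V (range (\<lambda>m. topspace X - E m))"
  have "countable \<U>" "\<forall>U\<in>\<U>. openin X U" "topspace X \<subseteq> \<Union>\<U>"
    using V by (auto simp: \<U>_def E_def upper_limit_def)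
  then obtain \<F> where \<F>: "\<F> \<subseteq> \<U>" "finite \<F>" "topspace X \<subseteq> \<Union>\<F>"
    using cc unfolding countably_compact_space_def by metis
  have "finite (\<F> - {V})" "\<F> - {V} \<subseteq> range (\<lambda>m. topspace X - E m)"
    using \<F> by (auto simp: \<U>_def)
  then obtain M where M: "finite M" "\<F> - {V} = (\<lambda>m. topspace X - E m) ` M"
    by (metis finite_subset_image)
  \<comment> \<open>No point of \<open>E k\<close> lies in a complement from the subcover, since
    \<open>E\<close> decreases and \<open>k\<close> bounds all indices in \<open>M\<close>; only
    \<open>V\<close> remains to cover it.\<close>
  obtain k where k: "\<forall>m\<in>M. m \<le> k"
    using M(1) finite_nat_set_iff_bounded_le by blast
  have "E k \<inter> topspace X \<subseteq> V"
  proof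
    fix x assume x: "x \<in> E k \<inter> topspace X"
    then obtain F where "F \<in> \<F>" "x \<in> F"
      using \<F>(3) by blast
    moreover have "x \<notin> topspace X - E m" if "m \<in> M" for m
      using x E_anti k that by auto
    ultimately show "x \<in> V"
      using M(2) by (cases "F = V") auto
  qed
  moreover have "D n \<subseteq> E k" if "n \<ge> k" for n
  proof -
    have "(\<Union>n\<in>{k..}. D n) \<subseteq> E k"
      unfolding E_def using D by (intro closure_of_subset) auto
    then show ?thesis using that by auto
  qed
  ultimately show ?thesis
    using D by blast
qed

text \<open>One member contains the whole tail from \<open>m\<close> on. The limit lies in the
  closure of that tail, hence in every later member.\<close>

lemma upper_limit_subset_cover:
  assumes U: "systematic_cover X U" and D: "\<And>n. n \<ge> m \<Longrightarrow> \<exists>a. D n \<subseteq> U a"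
  shows "\<exists>a. upper_limit X D \<subseteq> U a"
proof -
  obtain a where "(\<Union>n\<in>{m..}. D n) \<subseteq> U a"
    using systematic_cover_countable_Union[OF U, of "{m..}" D] D by auto
  then have "X closure_of (\<Union>n\<in>{m..}. D n) \<subseteq> X closure_of U a"
    by (rule closure_of_mono)
  then have "upper_limit X D \<subseteq> X closure_of U a"
    unfolding upper_limit_def by blast
  moreover obtain b where "a < b"
    by (rule greater_omega1)
  ultimately show ?thesis
    using systematic_coverD(3)[OF U] by blast
qed

text \<open>Each Lindelof piece of \<open>D n\<close> lies in a member of the Type I cover
  \<open>U\<close>, and countably many pieces lie in a common \<open>U c\<close>. The limit inside
  \<open>X closure_of V a\<close> is then a closed subset of the Lindelof set
  \<open>X closure_of U c\<close>.\<close>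

lemma Lindelof_upper_limit_inter:
  assumes U: "systematic_cover X U" and UL: "\<And>a. Lindelof_in X (X closure_of U a)"
    and V: "systematic_cover X V" and D: "\<And>n. closedin X (D n)"
    and L: "\<And>n a. n \<ge> m \<Longrightarrow> Lindelof_in X (X closure_of V a \<inter> D n)"
  shows "Lindelof_in X (X closure_of V a \<inter> upper_limit X D)"
proof -
  \<comment> \<open>The larger index supplies an open set \<open>V b\<close> around
    \<open>X closure_of V a\<close>; openness allows it to be moved under the closure of the
    tail.\<close>
  obtain b where "a < b"
    by (rule greater_omega1)
  have "\<exists>c. X closure_of V b \<inter> D n \<subseteq> U c" if "n \<ge> m" for n
    using that L closedin_subset[OF D]
    by (intro Lindelof_subset_systematic_cover[OF U]) auto
  then obtain c where "(\<Union>n\<in>{m..}. X closure_of V b \<inter> D n) \<subseteq> U c"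
    using systematic_cover_countable_Union[OF U, of "{m..}" "\<lambda>n. X closure_of V b \<inter> D n"] by auto
  moreover have "V b \<subseteq> X closure_of V b"
    using systematic_coverD(1)[OF V] by (simp add: closure_of_subset openin_subset)
  ultimately have *: "V b \<inter> (\<Union>n\<in>{m..}. D n) \<subseteq> U c"
    by blast
  have "X closure_of V a \<inter> upper_limit X D \<subseteq> V b \<inter> X closure_of (\<Union>n\<in>{m..}. D n)"
    using systematic_coverD(3)[OF V \<open>a < b\<close>] by (auto simp: upper_limit_def)
  also have "\<dots> \<subseteq> X closure_of (V b \<inter> (\<Union>n\<in>{m..}. D n))"
    by (rule openin_Int_closure_of_subset[OF systematic_coverD(1)[OF V]])
  also have "\<dots> \<subseteq> X closure_of U c"
    by (rule closure_of_mono[OF *])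
  finally show ?thesis
    by (intro Lindelof_in_closed_subset[OF UL[of c]] closedin_Int closedin_upper_limit) auto
qed

text \<open>A Lindelof limit would lie in one member of the Type I cover. That member would contain
  some \<open>D m\<close>, and its Lindelof closure would make \<open>D m\<close> Lindelof.\<close>

lemma upper_limit_not_Lindelof:
  assumes "type_I X" and cc: "countably_compact_space X"
    and D: "\<And>n. closedin X (D n)" and DL: "\<And>n. \<not> Lindelof_in X (D n)"
  shows "\<not> Lindelof_in X (upper_limit X D)"
proof
  assume L: "Lindelof_in X (upper_limit X D)"
  obtain U where U: "systematic_cover X U" and UL: "\<And>a. Lindelof_in X (X closure_of U a)"
    using \<open>type_I X\<close> by (auto simp: type_I_def)
  obtain a where "upper_limit X D \<subseteq> U a"
    using Lindelof_subset_systematic_cover[OF U L closedin_subset[OF closedin_upper_limit]] by blast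
  then obtain m where "\<forall>n\<ge>m. D n \<subseteq> U a"
    using upper_limit_subset_openD[where D = D, OF cc closedin_subset[OF D] systematic_coverD(1)[OF U]]
    by blast
  then have "D m \<subseteq> U a" by simp
  also have "\<dots> \<subseteq> X closure_of U a"
    using systematic_coverD(1)[OF U] by (simp add: closure_of_subset openin_subset)
  finally show False
    using Lindelof_in_closed_subset[OF UL D, of m a] DL by simp
qed

text \<open>The assumption \<open>dichotomy\<close> rules out sequences that alternate forever
  between lying in a member of \<open>V\<close> and not doing so. In either eventual case the tail
  decides which alternative of narrowness the limit satisfies.\<close>

lemma narrow_wrt_upper_limit:
  assumes "type_I X" and \<S>: "\<And>V. V \<in> \<S> \<Longrightarrow> systematic_cover X V"
    and D: "\<And>n. narrow_wrt \<S> X (D n)"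
    and dichotomy: "\<And>V. V \<in> \<S> \<Longrightarrow>
      \<exists>m. (\<forall>n\<ge>m. \<exists>a. D n \<subseteq> V a) \<or> (\<forall>n\<ge>m. \<not> (\<exists>a. D n \<subseteq> V a))"
  shows "narrow_wrt \<S> X (upper_limit X D)"
  unfolding narrow_wrt_def
proof (intro conjI ballI)
  fix V assume V: "V \<in> \<S>"
  obtain U where U: "systematic_cover X U" "\<And>a. Lindelof_in X (X closure_of U a)"
    using \<open>type_I X\<close> by (auto simp: type_I_def)
  have closed: "closedin X (D n)" for n
    using D by (simp add: narrow_wrt_def)
  obtain m where "(\<forall>n\<ge>m. \<exists>a. D n \<subseteq> V a) \<or> (\<forall>n\<ge>m. \<not> (\<exists>a. D n \<subseteq> V a))"
    using dichotomy[OF V] by blast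
  then show "(\<exists>a. upper_limit X D \<subseteq> V a) \<or>
      (\<forall>a. Lindelof_in X (X closure_of V a \<inter> upper_limit X D))"
  proof
    assume "\<forall>n\<ge>m. \<exists>a. D n \<subseteq> V a"
    then show ?thesis
      using upper_limit_subset_cover[OF \<S>[OF V], of m D] by simp
  next
    assume "\<forall>n\<ge>m. \<not> (\<exists>a. D n \<subseteq> V a)"
    then have "Lindelof_in X (X closure_of V a \<inter> D n)" if "n \<ge> m" for n a
      using D[of n] V that by (auto simp: narrow_wrt_def)
    then show ?thesis
      using Lindelof_upper_limit_inter[where D = D, OF U \<S>[OF V] closed] by blast
  qed
qed (rule closedin_upper_limit)


section \<open>Bounds of monotone sequences\<close>

text \<open>Once \<open>P\<close> fails it fails from there on. This yields the dichotomy for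
  increasing sequences, where lying in a member of a cover is inherited by earlier terms.\<close>

lemma eventually_constant_antimono:
  fixes P :: "nat \<Rightarrow> bool"
  assumes "\<And>m n. m \<le> n \<Longrightarrow> P n \<Longrightarrow> P m"
  shows "\<exists>m. (\<forall>n\<ge>m. P n) \<or> (\<forall>n\<ge>m. \<not> P n)"
  using assms by metis

lemma eventually_constant_mono:
  fixes P :: "nat \<Rightarrow> bool"
  assumes "\<And>m n. m \<le> n \<Longrightarrow> P m \<Longrightarrow> P n"
  shows "\<exists>m. (\<forall>n\<ge>m. P n) \<or> (\<forall>n\<ge>m. \<not> P n)"
  using assms by metis

definition narrow_sets_wrt :: "(omega1 \<Rightarrow> 'a set) set \<Rightarrow> 'a topology \<Rightarrow> 'a set set"
  where "narrow_sets_wrt \<S> X = {D. closedin X D \<and> \<not> Lindelof_in X D \<and> narrow_wrt \<S> X D}"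

text \<open>A member containing the limit contains almost all terms, and the order carries this down
  to every earlier term.\<close>

lemma increasing_narrow_wrt_bounded:
  fixes D :: "nat \<Rightarrow> 'a set"
  assumes "type_I X" "countably_compact_space X" "\<And>V. V \<in> \<S> \<Longrightarrow> systematic_cover X V"
    and D: "\<And>n. D n \<in> narrow_sets_wrt \<S> X"
    and mono: "\<And>m n. m < n \<Longrightarrow> narrow_le_wrt \<S> (D m) (D n)"
  shows "\<exists>L\<in>narrow_sets_wrt \<S> X. \<forall>n. narrow_le_wrt \<S> (D n) L"
proof (intro bexI allI)
  have closed: "closedin X (D n)" for n
    using D by (simp add: narrow_sets_wrt_def)
  have mono': "\<exists>a. D m \<subseteq> V a" if "V \<in> \<S>" "m \<le> n" "\<exists>a. D n \<subseteq> V a" for V m n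
  proof (cases "m = n")
    case False
    with \<open>m \<le> n\<close> have "narrow_le_wrt \<S> (D m) (D n)"
      by (intro mono) simp
    then show ?thesis
      using that(1,3) by (rule narrow_le_wrtD)
  qed (use that in simp)
  show "narrow_le_wrt \<S> (D n) (upper_limit X D)" for n
    unfolding narrow_le_wrt_def
  proof (intro ballI impI)
    fix V assume V: "V \<in> \<S>" "\<exists>a. upper_limit X D \<subseteq> V a"
    then obtain a where a: "upper_limit X D \<subseteq> V a"
      by blast
    obtain m where "\<forall>n\<ge>m. D n \<subseteq> V a"
      using upper_limit_subset_openD[where D = D, OF assms(2) closedin_subset[OF closed]
          systematic_coverD(1)[OF assms(3)[OF V(1)]] a] by blast
    \<comment> \<open>The index \<open>max m n\<close> is late enough for the inclusion to hold and
      is at least \<open>n\<close>, so the order applies.\<close>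
    then have "\<exists>b. D (max m n) \<subseteq> V b"
      by (intro exI[of _ a]) simp
    then show "\<exists>b. D n \<subseteq> V b"
      by (rule mono'[OF V(1) max.cobounded2])
  qed
  have "\<exists>m. (\<forall>n\<ge>m. \<exists>a. D n \<subseteq> V a) \<or> (\<forall>n\<ge>m. \<not> (\<exists>a. D n \<subseteq> V a))" if "V \<in> \<S>" for V
    by (rule eventually_constant_antimono) (erule (1) mono'[OF that])
  then have "narrow_wrt \<S> X (upper_limit X D)"
    using D by (intro narrow_wrt_upper_limit[OF assms(1,3)]) (simp_all add: narrow_sets_wrt_def)
  moreover have "\<not> Lindelof_in X (upper_limit X D)"
    using D by (intro upper_limit_not_Lindelof[OF assms(1,2)]) (simp_all add: narrow_sets_wrt_def)
  ultimately show "upper_limit X D \<in> narrow_sets_wrt \<S> X"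
    by (simp add: narrow_sets_wrt_def closedin_upper_limit)
qed

text \<open>If \<open>D n\<close> lies in a member, then every term of the tail starting at
  \<open>n\<close> lies in some member, and hence so does the limit.\<close>

lemma decreasing_narrow_wrt_bounded:
  fixes D :: "nat \<Rightarrow> 'a set"
  assumes "type_I X" "countably_compact_space X" and \<S>: "\<And>V. V \<in> \<S> \<Longrightarrow> systematic_cover X V"
    and D: "\<And>n. D n \<in> narrow_sets_wrt \<S> X"
    and mono: "\<And>m n. m < n \<Longrightarrow> narrow_le_wrt \<S> (D n) (D m)"
  shows "\<exists>L\<in>narrow_sets_wrt \<S> X. \<forall>n. narrow_le_wrt \<S> L (D n)"
proof (intro bexI allI)
  have closed: "closedin X (D n)" for n
    using D by (simp add: narrow_sets_wrt_def)
  have mono': "\<exists>a. D n \<subseteq> V a" if "V \<in> \<S>" "m \<le> n" "\<exists>a. D m \<subseteq> V a" for V m n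
  proof (cases "m = n")
    case False
    with \<open>m \<le> n\<close> have "narrow_le_wrt \<S> (D n) (D m)"
      by (intro mono) simp
    then show ?thesis
      using that(1,3) by (rule narrow_le_wrtD)
  qed (use that in simp)
  show "narrow_le_wrt \<S> (upper_limit X D) (D n)" for n
    unfolding narrow_le_wrt_def
  proof (intro ballI impI)
    fix V assume V: "V \<in> \<S>" "\<exists>a. D n \<subseteq> V a"
    show "\<exists>b. upper_limit X D \<subseteq> V b"
      by (rule upper_limit_subset_cover[OF \<S>[OF V(1)], of n]) (erule mono'[OF V(1) _ V(2)])
  qed
  have "\<exists>m. (\<forall>n\<ge>m. \<exists>a. D n \<subseteq> V a) \<or> (\<forall>n\<ge>m. \<not> (\<exists>a. D n \<subseteq> V a))" if "V \<in> \<S>" for V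
    by (rule eventually_constant_mono) (erule (1) mono'[OF that])
  then have "narrow_wrt \<S> X (upper_limit X D)"
    using D by (intro narrow_wrt_upper_limit[OF assms(1,3)]) (simp_all add: narrow_sets_wrt_def)
  moreover have "\<not> Lindelof_in X (upper_limit X D)"
    using D by (intro upper_limit_not_Lindelof[OF assms(1,2)]) (simp_all add: narrow_sets_wrt_def)
  ultimately show "upper_limit X D \<in> narrow_sets_wrt \<S> X"
    by (simp add: narrow_sets_wrt_def closedin_upper_limit)
qed

section \<open>From sequences of sets to sequences of classes\<close>

lemma upwards_countably_closed_classes:
  assumes le: "reflp le" "transp le"
    and bound: "\<And>D. \<lbrakk>\<And>n. D n \<in> A; \<And>m n. m < n \<Longrightarrow> le (D m) (D n)\<rbrakk> \<Longrightarrow> \<exists>u\<in>A. \<forall>n::nat. le (D n) u"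
  shows "upwards_countably_closed (A // equiv_of A le) (class_le le)"
  unfolding upwards_countably_closed_def
proof (intro allI impI)
  fix s :: "nat \<Rightarrow> 'a set"
  assume s: "(\<forall>n. s n \<in> A // equiv_of A le) \<and> (\<forall>m n. m < n \<longrightarrow> class_le le (s m) (s n) \<and> s m \<noteq> s n)"
  then have "\<forall>n. \<exists>C. C \<in> A \<and> s n = equiv_of A le `` {C}"
    by (meson quotientE)
  then obtain D where D: "\<And>n. D n \<in> A" "\<And>n. s n = equiv_of A le `` {D n}"
    by metis
  have "le (D m) (D n)" if "m < n" for m n
    using s that class_le_iff[OF le D(1)[of m] D(1)[of n]] D(2) by simp
  then obtain u where "u \<in> A" "\<And>n. le (D n) u"
    using bound[of D] D(1) by blast
  then show "\<exists>u\<in>A // equiv_of A le. \<forall>n. class_le le (s n) u"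
    by (intro bexI[of _ "equiv_of A le `` {u}"]) (simp_all add: D class_le_iff[OF le] quotientI)
qed

text \<open>This is the upward statement for the converse preorder, which induces the same
  equivalence and reverses the order of the classes.\<close>

lemma downwards_countably_closed_classes:
  assumes le: "reflp le" "transp le"
    and bound: "\<And>D. \<lbrakk>\<And>n. D n \<in> A; \<And>m n. m < n \<Longrightarrow> le (D n) (D m)\<rbrakk> \<Longrightarrow> \<exists>l\<in>A. \<forall>n::nat. le l (D n)"
  shows "downwards_countably_closed (A // equiv_of A le) (class_le le)"
proof -
  have "upwards_countably_closed (A // equiv_of A le\<inverse>\<inverse>) (class_le le\<inverse>\<inverse>)"
    using assms by (intro upwards_countably_closed_classes) (auto simp: reflp_def transp_def)
  moreover have "equiv_of A le\<inverse>\<inverse> = equiv_of A le" "class_le le\<inverse>\<inverse> P Q = class_le le Q P" for P Q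
    by (auto simp: equiv_of_def class_le_def)
  ultimately show ?thesis
    unfolding upwards_countably_closed_def downwards_countably_closed_def by (metis (no_types, lifting))
qed

text \<open>Agreement of \<open>le\<close> with \<open>narrow_le_wrt\<close> is required only on the
  narrow sets, because \<open>f_narrow_le\<close> is matched with the preimage covers only for
  subsets of \<open>topspace X\<close>.\<close>

lemma countably_closed_classes_narrow_wrt:
  assumes X: "type_I X" "countably_compact_space X" "\<And>V. V \<in> \<S> \<Longrightarrow> systematic_cover X V"
    and le: "reflp le" "transp le"
    and le_iff: "\<And>C D. \<lbrakk>C \<in> narrow_sets_wrt \<S> X; D \<in> narrow_sets_wrt \<S> X\<rbrakk> \<Longrightarrow>
      le C D \<longleftrightarrow> narrow_le_wrt \<S> C D"
  defines "P \<equiv> narrow_sets_wrt \<S> X // equiv_of (narrow_sets_wrt \<S> X) le"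
  shows "upwards_countably_closed P (class_le le)" "downwards_countably_closed P (class_le le)"
proof -
  show "upwards_countably_closed P (class_le le)"
    unfolding P_def
  proof (rule upwards_countably_closed_classes[OF le])
    fix D :: "nat \<Rightarrow> _"
    assume D: "\<And>n. D n \<in> narrow_sets_wrt \<S> X" "\<And>m n. m < n \<Longrightarrow> le (D m) (D n)"
    have "narrow_le_wrt \<S> (D m) (D n)" if "m < n" for m n
      using D(2)[OF that] le_iff[OF D(1) D(1)] by simp
    then obtain u where "u \<in> narrow_sets_wrt \<S> X" "\<forall>n. narrow_le_wrt \<S> (D n) u"
      using increasing_narrow_wrt_bounded[where D = D, OF X D(1)] by auto
    then show "\<exists>u\<in>narrow_sets_wrt \<S> X. \<forall>n. le (D n) u"
      using le_iff[OF D(1)] by auto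
  qed
  show "downwards_countably_closed P (class_le le)"
    unfolding P_def
  proof (rule downwards_countably_closed_classes[OF le])
    fix D :: "nat \<Rightarrow> _"
    assume D: "\<And>n. D n \<in> narrow_sets_wrt \<S> X" "\<And>m n. m < n \<Longrightarrow> le (D n) (D m)"
    have "narrow_le_wrt \<S> (D n) (D m)" if "m < n" for m n
      using D(2)[OF that] le_iff[OF D(1) D(1)] by simp
    then obtain l where "l \<in> narrow_sets_wrt \<S> X" "\<forall>n. narrow_le_wrt \<S> l (D n)"
      using decreasing_narrow_wrt_bounded[where D = D, OF X D(1)] by auto
    then show "\<exists>l\<in>narrow_sets_wrt \<S> X. \<forall>n. le l (D n)"
      using le_iff[OF _ D(1)] by auto
  qed
qed

theorem lemma6p9:
  fixes X :: "'a topology"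
  assumes "Hausdorff_space X" and "type_I X" and "countably_compact_space X"
  shows "upwards_countably_closed (narrow_poset X) (class_le (narrow_le X))
    \<and> downwards_countably_closed (narrow_poset X) (class_le (narrow_le X))
    \<and> upwards_countably_closed (f_narrow_poset X) (class_le (f_narrow_le X))
    \<and> downwards_countably_closed (f_narrow_poset X) (class_le (f_narrow_le X))"
proof -
  have narrow: "narrow_sets_wrt {U. systematic_cover X U} X = narrow_sets X"
    by (simp add: narrow_sets_wrt_def narrow_sets_def narrow_wrt_systematic_covers)
  have f_narrow: "narrow_sets_wrt (preimage_covers X) X = f_narrow_sets X"
    by (simp add: narrow_sets_wrt_def f_narrow_sets_def narrow_wrt_preimage_covers)
  have "systematic_cover X V" if "V \<in> preimage_covers X" for V
    using that systematic_cover_preimage_cover by (auto simp: preimage_covers_def)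
  moreover have "f_narrow_le X C D \<longleftrightarrow> narrow_le_wrt (preimage_covers X) C D"
    if "C \<in> f_narrow_sets X" "D \<in> f_narrow_sets X" for C D
    using that narrow_le_wrt_preimage_covers[of C X D] closedin_subset by (auto simp: f_narrow_sets_def)
  ultimately have "upwards_countably_closed (f_narrow_poset X) (class_le (f_narrow_le X))"
    "downwards_countably_closed (f_narrow_poset X) (class_le (f_narrow_le X))"
    using countably_closed_classes_narrow_wrt[OF assms(2,3), of "preimage_covers X" "f_narrow_le X"]
      reflp_f_narrow_le transp_f_narrow_le
    unfolding f_narrow f_narrow_poset_def by blast+
  moreover have "upwards_countably_closed (narrow_poset X) (class_le (narrow_le X))"
    "downwards_countably_closed (narrow_poset X) (class_le (narrow_le X))"
    using countably_closed_classes_narrow_wrt[OF assms(2,3), of "{U. systematic_cover X U}" "narrow_le X"]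
      reflp_narrow_le transp_narrow_le narrow_le_wrt_systematic_covers
    unfolding narrow narrow_poset_def by blast+
  ultimately show ?thesis by blast
qed

end
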